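(* Consider the time-dependent multi-agent optimization problem (MAOP) with data $n$, $T>0$, $I=[0,T]$, $q\in(0,1]$, $K_j$, $\Theta_j$, $f_j$, $g_j$, $x_{0j}$, $a_j$ ($1\le j\le n$) described in the context, and let $f,g,G,K$ be the associated maps defined there. Assume: (1) there are constants $l_G,\eta_G>0$ such that $\|G(s_2,x_2,u_2)-G(s_1,x_1,u_1)\|\le l_G(|s_2-s_1|+\|x_2-x_1\|+\|u_2-u_1\|)$ for all $s_1,s_2\in I$, $x_1,x_2,u_1,u_2\in R^n$, and, for all $s\in I$, $x,u\in R^n$ and $u_1,u_2\in K(u)$, $\langle G(s,x,u_2),u_1-u_2\rangle\ge 0$ implies $\langle G(s,x,u_1),u_1-u_2\rangle\ge\eta_G\|u_1-u_2\|^2$; (2) there is $l_K\ge 0$ such that $\|P_{K(u_2)}[\varpi]-P_{K(u_1)}[\varpi]\|\le l_K\|u_2-u_1\|$ for all $u_1,u_2,\varpi\in R^n$; (3) $g$ is continuous and there is $l_g>0$ with $\|g(s,x_2,u_2)-g(s,x_1,u_1)\|\le l_g(\|x_2-x_1\|+\|u_2-u_1\|)$ for all $s\in I$, $x_1,x_2,u_1,u_2\in R^n$; (4) $f$ is continuous and there is $l_f>0$ with $\|f(s,x_2)-f(s,x_1)\|\le l_f\|x_2-x_1\|$ for all $s\in I$, $x_1,x_2\in R^n$; (5) $2\dfrac{l_K^2}{\eta_G^2}\left(l_G\sqrt{4l_G^2+2\eta_G^2}+2l_G^2+\eta_G^2\right)<1$; (6) $0<\max_{j=1,\dots,n}|a_j|<1$.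 If $\varphi\in C(I,R_+)$ is a nondecreasing function, then there exists a real number $c_\varphi>0$ such that the optimal state $x^*$ of the MAOP satisfies $$\|z^*(s)-x^*(s)\|\le c_\varphi\,\varphi(s)\,\mathrm{E}_q(s)\quad\text{for all } s\in I,$$ where $(z^*,\upsilon^* )\in C(I,R^n)\times C(I,R^n)$ is any solution of the inequality system $$\begin{cases}\left\|{}^{C}_{0}\mathrm{D}_s^{q}z^*(s)-f(s,z^*(s))-g(s,z^*(s),\upsilon^*(s))\right\|\le\varphi(s), & s\in I,\\ \langle G(s,z^*(s),\upsilon^*(s)),w-\upsilon^*(s)\rangle\ge 0\ \ \forall w\in K(\upsilon^*(s)), & s\in I,\\ z^*(0)=x^*(0).\end{cases}$$
   Context: $R_+=[0,\infty)$. There are $n$ agents. For agent $j$ ($1\le j\le n$), $x_j(s)\in R$ is the state and $u_j(s)\in R$ the strategy at time $s\in I$; write $x=(x_1,\dots,x_n)^\top=(x_j,x_{-j})$ and $u=(u_1,\dots,u_n)^\top=(u_j,u_{-j})$, where $u_{-j}\in R^{n-1}$ omits the $j$-th component (similarly $x_{-j}$). $K_j:R^{n-1}\to 2^{R}$ is set-valued with nonempty closed convex values; $\Theta_j:R^n\times R^n\to R$, written $\Theta_j(x,u)=\Theta_j(x_j,x_{-j},u_j,u_{-j})$, is agent $j$'s cost function, convex and continuously differentiable with respect to $u_j$; $f_j:I\times R\to R$, $g_j:I\times R\times R\to R$; $x_{0j},a_j\in R$. The MAOP is: for every $j$ and every $s\in I$, $$\min_{u_j(s)\in K_j(u^*_{-j}(s))}\Theta_j(x_j(s),x^*_{-j}(s),u_j(s),u^*_{-j}(s))$$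 subject to ${}^{C}_{0}\mathrm{D}^q_s x_j(s)=f_j(s,x_j(s))+g_j(s,x_j(s),u_j(s))$ and $x_j(0)=x_{0j}+a_j\frac{1}{T}\int_0^T x_j(\zeta)\,d\zeta$, where ${}^{C}_{0}\mathrm{D}^q_s$ is the Caputo derivative. A general Nash equilibrium (solution, optimal pair; $x^*$ is then the optimal state) is a pair $(x^*,u^* )\in C(I,R^n)\times C(I,R^n)$ such that for each $j$: (i) for all $s\in I$, $x_j^*(s)=x_{0j}+\frac{a_j}{T}\int_0^T x_j^*(\zeta)\,d\zeta+\frac{1}{\Gamma(q)}\int_0^s(s-\zeta)^{q-1}[f_j(\zeta,x_j^*(\zeta))+g_j(\zeta,x_j^*(\zeta),u_j^*(\zeta))]\,d\zeta$ (the integral form of the state equation); (ii) for all $s\in I$, $u_j^*(s)\in K_j(u_{-j}^*(s))$ and $u_j^*(s)$ minimizes $w\mapsto\Theta_j(x_j^*(s),x_{-j}^*(s),w,u_{-j}^*(s))$ over $w\in K_j(u^*_{-j}(s))$. Associated maps: $f(s,y)=(f_1(s,y_1),\dots,f_n(s,y_n))^\top$, $g(s,y,v)=(g_1(s,y_1,v_1),\dots,g_n(s,y_n,v_n))^\top$, $G(s,y,v)=\left(\nabla_{v_1}\Theta_1(y,v),\dots,\nabla_{v_n}\Theta_n(y,v)\right)$, $K(v)=\prod_{j=1}^nK_j(v_{-j})$ for $s\in I$, $y,v\in R^n$. $P_C$ is the metric projection onto the nonempty closed convex set $C$. $\mathrm{E}_q(t)=\sum_{n=0}^\infty\frac{t^n}{\Gamma(nq+1)}$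 is the Mittag-Leffler function. In the inequality system the second line includes $\upsilon^*(s)\in K(\upsilon^*(s))$. A pair $(z^*,\upsilon^* )$ satisfies the inequality system iff, besides the second and third lines, there is $h\in C(I,R^n)$ with $\|h(s)\|\le\varphi(s)$ on $I$ and $z^*(s)=z^*(0)+\frac{1}{\Gamma(q)}\int_0^s(s-\zeta)^{q-1}[f(\zeta,z^*(\zeta))+g(\zeta,z^*(\zeta),\upsilon^*(\zeta))+h(\zeta)]\,d\zeta$ for all $s\in I$. *)

theory Defs
  imports "HOL-Analysis.Analysis"
begin

text \<open>
  The agents are the elements of a finite index type \<open>'n\<close>, so \<open>R^n\<close> is \<open>real ^ 'n\<close> with the
  Euclidean norm. The space \<open>R^(n-1)\<close> of vectors without \<open>j\<close>-th component is the function space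
  \<open>(- {j}) \<rightarrow>\<^sub>E UNIV\<close> over the remaining indices.
\<close>

definition omit :: "'n \<Rightarrow> real ^ 'n \<Rightarrow> ('n \<Rightarrow> real)" where
  "omit j v = restrict (($) v) (- {j})"

text \<open>\<open>subst_comp j w v\<close> is the vector \<open>(w, v_{-j})\<close>, with \<open>w\<close> in position \<open>j\<close>.\<close>

definition subst_comp :: "'n::finite \<Rightarrow> real \<Rightarrow> real ^ 'n \<Rightarrow> real ^ 'n" where
  "subst_comp j w v = (\<chi> i. if i = j then w else v $ i)"

definition convex_C1_own_strategy ::
    "('n::finite \<Rightarrow> real ^ 'n \<Rightarrow> real ^ 'n \<Rightarrow> real) \<Rightarrow> bool" where
  "convex_C1_own_strategy \<Theta> \<longleftrightarrow>
     (\<forall>j y v. convex_on UNIV (\<lambda>w. \<Theta> j y (subst_comp j w v)) \<and>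
        (\<lambda>w. \<Theta> j y (subst_comp j w v)) differentiable_on UNIV \<and>
        continuous_on UNIV (deriv (\<lambda>w. \<Theta> j y (subst_comp j w v))))"

definition stack_f ::
    "('n::finite \<Rightarrow> real \<Rightarrow> real \<Rightarrow> real) \<Rightarrow> real \<Rightarrow> real ^ 'n \<Rightarrow> real ^ 'n" where
  "stack_f f s y = (\<chi> j. f j s (y $ j))"

definition stack_g ::
    "('n::finite \<Rightarrow> real \<Rightarrow> real \<Rightarrow> real \<Rightarrow> real) \<Rightarrow>
      real \<Rightarrow> real ^ 'n \<Rightarrow> real ^ 'n \<Rightarrow> real ^ 'n" where
  "stack_g g s y v = (\<chi> j. g j s (y $ j) (v $ j))"

text \<open>The time argument of \<open>pseudo_grad\<close> is a dummy, because the costs do not depend on time.\<close>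

definition pseudo_grad ::
    "('n::finite \<Rightarrow> real ^ 'n \<Rightarrow> real ^ 'n \<Rightarrow> real) \<Rightarrow>
      real \<Rightarrow> real ^ 'n \<Rightarrow> real ^ 'n \<Rightarrow> real ^ 'n" where
  "pseudo_grad \<Theta> s y v = (\<chi> j. deriv (\<lambda>w. \<Theta> j y (subst_comp j w v)) (v $ j))"

definition prod_constraint ::
    "('n::finite \<Rightarrow> ('n \<Rightarrow> real) \<Rightarrow> real set) \<Rightarrow> real ^ 'n \<Rightarrow> (real ^ 'n) set" where
  "prod_constraint K v = {w. \<forall>j. w $ j \<in> K j (omit j v)}"

text \<open>Riemann-Liouville integral; at \<open>\<zeta> = s\<close> the kernel is \<open>0 powr (q - 1) = 0\<close>, which does not affect the value.\<close>

definition frac_integral :: "real \<Rightarrow> (real \<Rightarrow> 'a::euclidean_space) \<Rightarrow> real \<Rightarrow> 'a" where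
  "frac_integral q y s =
     (1 / Gamma q) *\<^sub>R integral {0..s} (\<lambda>\<zeta>. (s - \<zeta>) powr (q - 1) *\<^sub>R y \<zeta>)"

definition mittag_leffler :: "real \<Rightarrow> real \<Rightarrow> real" where
  "mittag_leffler q t = (\<Sum>n. t ^ n / Gamma (real n * q + 1))"

definition general_Nash_equilibrium ::
    "real \<Rightarrow> real \<Rightarrow> ('n::finite \<Rightarrow> ('n \<Rightarrow> real) \<Rightarrow> real set) \<Rightarrow>
      ('n \<Rightarrow> real ^ 'n \<Rightarrow> real ^ 'n \<Rightarrow> real) \<Rightarrow>
      ('n \<Rightarrow> real \<Rightarrow> real \<Rightarrow> real) \<Rightarrow> ('n \<Rightarrow> real \<Rightarrow> real \<Rightarrow> real \<Rightarrow> real) \<Rightarrow>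
      ('n \<Rightarrow> real) \<Rightarrow> ('n \<Rightarrow> real) \<Rightarrow>
      (real \<Rightarrow> real ^ 'n) \<Rightarrow> (real \<Rightarrow> real ^ 'n) \<Rightarrow> bool" where
  "general_Nash_equilibrium T q K \<Theta> f g x0 a x u \<longleftrightarrow>
     continuous_on {0..T} x \<and> continuous_on {0..T} u \<and>
     (\<forall>j. \<forall>s\<in>{0..T}.
        x s $ j = x0 j + a j / T * integral {0..T} (\<lambda>\<zeta>. x \<zeta> $ j)
          + frac_integral q (\<lambda>\<zeta>. f j \<zeta> (x \<zeta> $ j) + g j \<zeta> (x \<zeta> $ j) (u \<zeta> $ j)) s \<and>
        is_arg_min (\<lambda>w. \<Theta> j (x s) (subst_comp j w (u s)))
          (\<lambda>w. w \<in> K j (omit j (u s))) (u s $ j))"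

text \<open>
  The inequality for the Caputo derivative is understood in integral form, with a continuous
  defect \<open>h\<close>; \<open>\<xi>\<close> is the prescribed initial value of \<open>z\<close>.
\<close>

definition solves_inequality_system ::
    "real \<Rightarrow> real \<Rightarrow> ('n::finite \<Rightarrow> ('n \<Rightarrow> real) \<Rightarrow> real set) \<Rightarrow>
      ('n \<Rightarrow> real ^ 'n \<Rightarrow> real ^ 'n \<Rightarrow> real) \<Rightarrow>
      ('n \<Rightarrow> real \<Rightarrow> real \<Rightarrow> real) \<Rightarrow> ('n \<Rightarrow> real \<Rightarrow> real \<Rightarrow> real \<Rightarrow> real) \<Rightarrow>
      (real \<Rightarrow> real) \<Rightarrow> real ^ 'n \<Rightarrow>
      (real \<Rightarrow> real ^ 'n) \<Rightarrow> (real \<Rightarrow> real ^ 'n) \<Rightarrow> bool" where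
  "solves_inequality_system T q K \<Theta> f g \<phi> \<xi> z \<upsilon> \<longleftrightarrow>
     continuous_on {0..T} z \<and> continuous_on {0..T} \<upsilon> \<and>
     (\<exists>h. continuous_on {0..T} h \<and> (\<forall>s\<in>{0..T}. norm (h s) \<le> \<phi> s) \<and>
        (\<forall>s\<in>{0..T}. z s = z 0 +
           frac_integral q (\<lambda>\<zeta>. stack_f f \<zeta> (z \<zeta>) + stack_g g \<zeta> (z \<zeta>) (\<upsilon> \<zeta>) + h \<zeta>) s)) \<and>
     (\<forall>s\<in>{0..T}. \<upsilon> s \<in> prod_constraint K (\<upsilon> s) \<and>
        (\<forall>w\<in>prod_constraint K (\<upsilon> s). pseudo_grad \<Theta> s (z s) (\<upsilon> s) \<bullet> (w - \<upsilon> s) \<ge> 0)) \<and>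
     z 0 = \<xi>"

end

theory Submission
  imports Defs
begin

text \<open>
  The strategies are controlled by the states at each fixed time, and after that only a scalar
  fractional integral inequality remains.

  At a fixed time \<open>s\<close>, first-order optimality of every agent makes the equilibrium strategy \<open>u\<close> a
  solution of the quasi-variational inequality with map \<open>G(s, x, -)\<close> and constraint set \<open>K(u)\<close>
  (\<open>Nash_imp_variational_inequality\<close>), and \<open>\<upsilon>\<close> solves the one with \<open>G(s, z, -)\<close> and \<open>K(\<upsilon>)\<close>.
  Two such solutions are compared by \<open>quasi_variational_stability\<close>: project a gradient step of
  length \<open>\<rho>\<close> from \<open>\<upsilon>\<close> onto the other constraint set \<open>K(u)\<close>. The resulting point is within
  \<open>l_K \<parallel>\<upsilon> - u\<parallel>\<close> of \<open>\<upsilon>\<close>, and strong pseudomonotonicity bounds its distance to \<open>u\<close>. Letting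
  \<open>\<rho> \<rightarrow> \<infinity>\<close> gives \<open>\<parallel>\<upsilon> - u\<parallel> \<le> (1 + l_G/\<eta>) l_K \<parallel>\<upsilon> - u\<parallel> + (l_G/\<eta>) \<parallel>z - x\<parallel>\<close>. The smallness
  hypothesis implies \<open>(1 + l_G/\<eta>) l_K < 1\<close>, so \<open>\<parallel>\<upsilon> - u\<parallel> \<le> L \<parallel>z - x\<parallel>\<close> with a constant \<open>L\<close>.

  Since \<open>z 0 = x 0\<close>, the nonlocal initial condition cancels, and the error \<open>e = \<parallel>z - x\<parallel>\<close> satisfies
  \<open>e \<le> I^q (M e + \<phi>)\<close> with \<open>M = l_f + l_g (1 + L)\<close>, where \<open>I^q\<close> is the fractional integral. The
  weakly singular Gronwall inequality \<open>fractional_Gronwall\<close> turns this into \<open>e \<le> c \<phi>\<close> with \<open>c\<close>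
  depending only on \<open>T\<close>, \<open>q\<close> and \<open>M\<close>; as \<open>\<phi>\<close> is nondecreasing, its value at the current time
  bounds it on the whole history. The Mittag-Leffler factor can then be inserted because it is at least 1
  on \<open>[0, T]\<close> (\<open>mittag_leffler_ge_1\<close>).
\<close>

section \<open>Stability of quasi-variational inequalities\<close>

text \<open>
  A solution of a variational inequality is a fixed point of every projected gradient step: the
  scalar product with \<open>p\<close> only adds to the squared distance from \<open>v - \<rho> p\<close>.
\<close>

lemma closest_point_gradient_step:
  fixes C :: "'a::euclidean_space set"
  assumes C: "closed C" "convex C" and v: "v \<in> C" and "\<rho> \<ge> 0"
    and VI: "\<And>w. w \<in> C \<Longrightarrow> p \<bullet> (w - v) \<ge> 0"
  shows "closest_point C (v - \<rho> *\<^sub>R p) = v"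
proof -
  have "dist (v - \<rho> *\<^sub>R p) v \<le> dist (v - \<rho> *\<^sub>R p) z" if "z \<in> C" for z
  proof -
    have "(norm (\<rho> *\<^sub>R p))\<^sup>2 \<le> (norm (\<rho> *\<^sub>R p))\<^sup>2 + 2 * (\<rho> * (p \<bullet> (z - v))) + (norm (z - v))\<^sup>2"
      using VI[OF that] \<open>\<rho> \<ge> 0\<close> by (simp add: mult_nonneg_nonneg)
    also have "\<dots> = (norm (v - \<rho> *\<^sub>R p - z))\<^sup>2"
      unfolding power2_norm_eq_inner
      by (simp add: inner_diff_left inner_diff_right algebra_simps inner_commute)
    finally have "norm (\<rho> *\<^sub>R p) \<le> norm (v - \<rho> *\<^sub>R p - z)"
      by (rule power2_le_imp_le) simp
    then show ?thesis by (simp add: dist_norm)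
  qed
  then show ?thesis using closest_point_unique[OF C(2,1) v] by metis
qed

text \<open>
  Here \<open>k\<close> measures how far the two constraint sets are apart and \<open>r\<close> how far the two maps are
  apart. Comparing \<open>v\<^sub>1\<close> with the projection of \<open>v\<^sub>2\<close> itself would leave a term of the size of
  \<open>A\<^sub>2 v\<^sub>2\<close>, which is not under control. The projection \<open>w\<close> of the gradient step \<open>v\<^sub>2 - \<rho> A\<^sub>2 v\<^sub>2\<close>
  avoids it: \<open>w\<close> is \<open>k\<close>-close to \<open>v\<^sub>2\<close>, the projection of the same point onto \<open>C\<^sub>2\<close>, and the
  projection inequality for \<open>w\<close> brings in \<open>A\<^sub>2 v\<^sub>2\<close> only through the difference with \<open>A\<^sub>1 w\<close>. The
  price is an error \<open>k / (\<rho> \<eta>)\<close>, which vanishes as \<open>\<rho> \<rightarrow> \<infinity>\<close>.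
\<close>

lemma quasi_variational_stability:
  fixes C\<^sub>1 C\<^sub>2 :: "'a::euclidean_space set" and A\<^sub>1 A\<^sub>2 :: "'a \<Rightarrow> 'a"
  assumes C1: "closed C\<^sub>1" "convex C\<^sub>1" and C2: "closed C\<^sub>2" "convex C\<^sub>2"
    and v1: "v\<^sub>1 \<in> C\<^sub>1" and v2: "v\<^sub>2 \<in> C\<^sub>2"
    and VI1: "\<And>w. w \<in> C\<^sub>1 \<Longrightarrow> A\<^sub>1 v\<^sub>1 \<bullet> (w - v\<^sub>1) \<ge> 0"
    and VI2: "\<And>w. w \<in> C\<^sub>2 \<Longrightarrow> A\<^sub>2 v\<^sub>2 \<bullet> (w - v\<^sub>2) \<ge> 0"
    and "\<eta> > 0" "l \<ge> 0"
    and pseudo: "\<And>w. w \<in> C\<^sub>1 \<Longrightarrow> A\<^sub>1 v\<^sub>1 \<bullet> (w - v\<^sub>1) \<ge> 0 \<Longrightarrow>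
        A\<^sub>1 w \<bullet> (w - v\<^sub>1) \<ge> \<eta> * (norm (w - v\<^sub>1))\<^sup>2"
    and lip: "\<And>w. norm (A\<^sub>1 w - A\<^sub>2 v\<^sub>2) \<le> l * (r + norm (w - v\<^sub>2))"
    and proj: "\<And>\<omega>. norm (closest_point C\<^sub>2 \<omega> - closest_point C\<^sub>1 \<omega>) \<le> k"
  shows "norm (v\<^sub>2 - v\<^sub>1) \<le> (1 + l / \<eta>) * k + l / \<eta> * r"
proof (rule field_le_epsilon)
  fix e :: real assume "e > 0"
  have "k \<ge> 0" using proj[of 0] norm_ge_zero order_trans by blast
  \<comment> \<open>Large enough for \<open>k / (\<rho> * \<eta>) \<le> e\<close>; the 1 keeps \<open>\<rho>\<close> positive when \<open>k = 0\<close>.\<close>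
  define \<rho> where "\<rho> = (k + 1) / (\<eta> * e)"
  have "\<rho> > 0" using \<open>k \<ge> 0\<close> \<open>\<eta> > 0\<close> \<open>e > 0\<close> by (simp add: \<rho>_def)
  define w where "w = closest_point C\<^sub>1 (v\<^sub>2 - \<rho> *\<^sub>R A\<^sub>2 v\<^sub>2)"
  define D where "D = norm (w - v\<^sub>1)"
  have w: "w \<in> C\<^sub>1" using closest_point_in_set[OF C1(1)] v1 by (auto simp: w_def)
  have wk: "norm (w - v\<^sub>2) \<le> k"
    using proj[of "v\<^sub>2 - \<rho> *\<^sub>R A\<^sub>2 v\<^sub>2"] closest_point_gradient_step[OF C2 v2 _ VI2, of \<rho>] \<open>\<rho> > 0\<close>
    by (simp add: w_def norm_minus_commute)
  have "(v\<^sub>2 - \<rho> *\<^sub>R A\<^sub>2 v\<^sub>2 - w) \<bullet> (v\<^sub>1 - w) \<le> 0"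
    unfolding w_def by (rule closest_point_dot[OF C1(2,1) v1])
  moreover have "\<rho> * (A\<^sub>1 w \<bullet> (w - v\<^sub>1)) \<ge> \<rho> * (\<eta> * D\<^sup>2)"
    unfolding D_def using pseudo[OF w VI1[OF w]] \<open>\<rho> > 0\<close> by simp
  ultimately have "\<rho> * (\<eta> * D\<^sup>2) \<le> (\<rho> *\<^sub>R (A\<^sub>1 w - A\<^sub>2 v\<^sub>2) - (w - v\<^sub>2)) \<bullet> (w - v\<^sub>1)"
    by (simp add: inner_diff_left inner_diff_right algebra_simps)
  also have "\<dots> \<le> norm (\<rho> *\<^sub>R (A\<^sub>1 w - A\<^sub>2 v\<^sub>2) - (w - v\<^sub>2)) * D"
    unfolding D_def by (rule norm_cauchy_schwarz)
  also have "\<dots> \<le> (\<rho> * (l * (r + k)) + k) * D"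
  proof (rule mult_right_mono)
    have "norm (A\<^sub>1 w - A\<^sub>2 v\<^sub>2) \<le> l * (r + k)"
      using lip[of w] wk \<open>l \<ge> 0\<close> by (meson add_left_mono mult_left_mono order_trans)
    then have "norm (\<rho> *\<^sub>R (A\<^sub>1 w - A\<^sub>2 v\<^sub>2)) \<le> \<rho> * (l * (r + k))"
      using \<open>\<rho> > 0\<close> by simp
    then show "norm (\<rho> *\<^sub>R (A\<^sub>1 w - A\<^sub>2 v\<^sub>2) - (w - v\<^sub>2)) \<le> \<rho> * (l * (r + k)) + k"
      using wk norm_triangle_ineq4[of "\<rho> *\<^sub>R (A\<^sub>1 w - A\<^sub>2 v\<^sub>2)" "w - v\<^sub>2"] by linarith
  qed (simp add: D_def)
  finally have *: "(\<rho> * \<eta> * D) * D \<le> (\<rho> * (l * (r + k)) + k) * D"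
    by (simp add: power2_eq_square mult.assoc)
  have "0 \<le> l * (r + k)"
    using lip[of w] wk \<open>l \<ge> 0\<close> by (meson add_left_mono mult_left_mono order_trans norm_ge_zero)
  then have nonneg: "0 \<le> \<rho> * (l * (r + k)) + k" using \<open>\<rho> > 0\<close> \<open>k \<ge> 0\<close> by simp
  have "\<rho> * \<eta> * D \<le> \<rho> * (l * (r + k)) + k"
  proof (cases "D = 0")
    case True then show ?thesis using nonneg by simp
  next
    case False
    then have "D > 0" by (simp add: D_def)
    with * show ?thesis by (rule mult_right_le_imp_le)
  qed
  then have "D \<le> (\<rho> * (l * (r + k)) + k) / (\<rho> * \<eta>)"
    using \<open>\<rho> > 0\<close> \<open>\<eta> > 0\<close> by (simp add: pos_le_divide_eq mult.commute)
  also have "\<dots> = l / \<eta> * (r + k) + k / (\<rho> * \<eta>)"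
    using \<open>\<rho> > 0\<close> \<open>\<eta> > 0\<close> by (simp add: field_simps)
  also have "k / (\<rho> * \<eta>) = k / (k + 1) * e"
    using \<open>k \<ge> 0\<close> \<open>e > 0\<close> \<open>\<eta> > 0\<close> by (simp add: \<rho>_def)
  also have "k / (k + 1) * e \<le> e"
    using \<open>k \<ge> 0\<close> \<open>e > 0\<close> by (simp add: field_simps)
  finally have "D \<le> l / \<eta> * (r + k) + e" by simp
  moreover have "norm (v\<^sub>2 - v\<^sub>1) \<le> D + norm (w - v\<^sub>2)"
    unfolding D_def using norm_triangle_ineq4[of "w - v\<^sub>1" "w - v\<^sub>2"] by simp
  ultimately show "norm (v\<^sub>2 - v\<^sub>1) \<le> (1 + l / \<eta>) * k + l / \<eta> * r + e"
    using wk by (simp add: algebra_simps add_divide_distrib)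
qed

section \<open>From Nash equilibria to variational inequalities\<close>

text \<open>
  Otherwise \<open>F\<close> would decrease strictly along the start of the segment from \<open>u\<close> to \<open>w\<close>, which
  stays in \<open>C\<close>.
\<close>

lemma arg_min_imp_deriv_nonneg:
  fixes F :: "real \<Rightarrow> real"
  assumes min: "is_arg_min F (\<lambda>w. w \<in> C) u" and "convex C" "w \<in> C"
    and diff: "F differentiable (at u)"
  shows "deriv F u * (w - u) \<ge> 0"
proof (rule ccontr)
  assume neg: "\<not> deriv F u * (w - u) \<ge> 0"
  have u: "u \<in> C" and le: "\<And>y. y \<in> C \<Longrightarrow> F u \<le> F y"
    using min by (auto simp: is_arg_min_def not_less)
  have "DERIV F u :> deriv F u"
    using diff DERIV_deriv_iff_real_differentiable by blast
  then have "DERIV (\<lambda>t. F (u + t * (w - u))) 0 :> deriv F u * (w - u)"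
    by (auto intro!: DERIV_chain2[where f = F] derivative_eq_intros)
  then obtain d where "d > 0" and d: "\<And>h. 0 < h \<Longrightarrow> h < d \<Longrightarrow> F (u + h * (w - u)) < F u"
    using DERIV_neg_dec_right[of "\<lambda>t. F (u + t * (w - u))" "deriv F u * (w - u)" 0] neg by auto
  define h where "h = min (d / 2) 1"
  have h: "0 < h" "h < d" "h \<le> 1" using \<open>d > 0\<close> by (auto simp: h_def)
  have "(1 - h) *\<^sub>R u + h *\<^sub>R w \<in> C"
    using \<open>convex C\<close> u \<open>w \<in> C\<close> h by (intro convexD_alt) auto
  then have "u + h * (w - u) \<in> C" by (simp add: algebra_simps)
  then show False using le d[OF h(1,2)] by force
qed

lemma
  fixes K :: "'n::finite \<Rightarrow> ('n \<Rightarrow> real) \<Rightarrow> real set"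
  assumes K: "\<And>j p. p \<in> (- {j}) \<rightarrow>\<^sub>E UNIV \<Longrightarrow> closed (K j p) \<and> convex (K j p)"
  shows closed_prod_constraint: "closed (prod_constraint K v)"
    and convex_prod_constraint: "convex (prod_constraint K v)"
proof -
  have p: "omit j v \<in> (- {j}) \<rightarrow>\<^sub>E UNIV" for j by (auto simp: omit_def)
  have eq: "prod_constraint K v = (\<Inter>j. (\<lambda>w. w $ j) -` K j (omit j v))"
    by (auto simp: prod_constraint_def)
  show "closed (prod_constraint K v)"
    unfolding eq using K[OF p] by (auto intro!: closed_INT closed_vimage continuous_intros)
  show "convex (prod_constraint K v)"
    unfolding eq using K[OF p]
    by (auto intro!: convex_INT convex_linear_vimage bounded_linear.linear[OF bounded_linear_vec_nth])
qed

text \<open>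
  The constraint set is a product, so the componentwise first-order conditions add up to one
  variational inequality for the pseudo-gradient.
\<close>

lemma Nash_imp_variational_inequality:
  assumes cost: "convex_C1_own_strategy \<Theta>"
    and K: "\<And>j p. p \<in> (- {j}) \<rightarrow>\<^sub>E UNIV \<Longrightarrow> convex (K j p)"
    and min: "\<And>j. is_arg_min (\<lambda>w. \<Theta> j y (subst_comp j w v)) (\<lambda>w. w \<in> K j (omit j v)) (v $ j)"
  shows "v \<in> prod_constraint K v"
    and "w \<in> prod_constraint K v \<Longrightarrow> pseudo_grad \<Theta> s y v \<bullet> (w - v) \<ge> 0"
proof -
  show "v \<in> prod_constraint K v" using min by (auto simp: prod_constraint_def is_arg_min_def)
  assume w: "w \<in> prod_constraint K v"
  have "deriv (\<lambda>w. \<Theta> j y (subst_comp j w v)) (v $ j) * (w $ j - v $ j) \<ge> 0" for j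
  proof (rule arg_min_imp_deriv_nonneg[OF min])
    show "convex (K j (omit j v))" by (rule K) (auto simp: omit_def)
    show "w $ j \<in> K j (omit j v)" using w by (simp add: prod_constraint_def)
    show "(\<lambda>w. \<Theta> j y (subst_comp j w v)) differentiable at (v $ j)"
      using cost by (simp add: convex_C1_own_strategy_def differentiable_on_def)
  qed
  then show "pseudo_grad \<Theta> s y v \<bullet> (w - v) \<ge> 0"
    by (simp add: inner_vec_def pseudo_grad_def sum_nonneg)
qed

section \<open>The fractional integral\<close>

lemma has_integral_kernel:
  fixes s p :: real
  assumes "p > 0" "s \<ge> 0"
  shows "((\<lambda>\<zeta>. (s - \<zeta>) powr (p - 1)) has_integral s powr p / p) {0..s}"
proof -
  have "((\<lambda>x. x powr (p - 1)) has_integral s powr p / p) (cbox 0 s)"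
    using has_integral_powr_from_0[of "p - 1" s] assms by simp
  from has_integral_affinity[OF this, of "-1" s] show ?thesis
    by (simp add: algebra_simps image_add_atLeastAtMost image_diff_atLeastAtMost)
qed

text \<open>
  The kernel is nonnegative and integrable, hence absolutely integrable, and remains integrable
  after multiplication by a bounded measurable function.
\<close>

lemma kernel_integrable:
  fixes y :: "real \<Rightarrow> 'a::euclidean_space"
  assumes "p > 0" and y: "continuous_on {0..s} y"
  shows "(\<lambda>\<zeta>. (s - \<zeta>) powr (p - 1) *\<^sub>R y \<zeta>) integrable_on {0..s}"
proof (cases "s \<ge> 0")
  case True
  have "(\<lambda>\<zeta>. (s - \<zeta>) powr (p - 1)) absolutely_integrable_on {0..s}"
    by (rule nonnegative_absolutely_integrable_1)
      (use has_integral_kernel[OF \<open>p > 0\<close> True] in \<open>auto simp: integrable_on_def\<close>)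
  moreover have "bounded (y ` {0..s})"
    by (intro compact_imp_bounded compact_continuous_image y) simp
  moreover have "y \<in> borel_measurable (lebesgue_on {0..s})"
    by (intro continuous_imp_measurable_on_sets_lebesgue y) simp
  moreover have "bilinear (\<lambda>(v::'a) k. k *\<^sub>R v)"
    by (simp add: bilinear_def linear_iff algebra_simps)
  ultimately have "(\<lambda>\<zeta>. (s - \<zeta>) powr (p - 1) *\<^sub>R y \<zeta>) absolutely_integrable_on {0..s}"
    using absolutely_integrable_bounded_measurable_product[of "\<lambda>v k. k *\<^sub>R v" y "{0..s}"] by simp
  then show ?thesis by (rule set_lebesgue_integral_eq_integral(1))
qed (simp add: integrable_on_empty)

lemma frac_integral_linear:
  fixes y y' :: "real \<Rightarrow> 'a::euclidean_space"
  assumes "q > 0" "continuous_on {0..s} y" "continuous_on {0..s} y'"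
  shows "frac_integral q (\<lambda>\<zeta>. a *\<^sub>R y \<zeta> + b *\<^sub>R y' \<zeta>) s
      = a *\<^sub>R frac_integral q y s + b *\<^sub>R frac_integral q y' s"
proof -
  let ?k = "\<lambda>\<zeta>. (s - \<zeta>) powr (q - 1)"
  have "integral {0..s} (\<lambda>\<zeta>. ?k \<zeta> *\<^sub>R (a *\<^sub>R y \<zeta> + b *\<^sub>R y' \<zeta>))
      = integral {0..s} (\<lambda>\<zeta>. a *\<^sub>R (?k \<zeta> *\<^sub>R y \<zeta>) + b *\<^sub>R (?k \<zeta> *\<^sub>R y' \<zeta>))"
    by (simp add: algebra_simps)
  also have "\<dots> = a *\<^sub>R integral {0..s} (\<lambda>\<zeta>. ?k \<zeta> *\<^sub>R y \<zeta>) + b *\<^sub>R integral {0..s} (\<lambda>\<zeta>. ?k \<zeta> *\<^sub>R y' \<zeta>)"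
    using kernel_integrable[OF assms(1,2)] kernel_integrable[OF assms(1,3)]
    by (simp only: Henstock_Kurzweil_Integration.integral_add integrable_cmul integral_cmul)
  finally show ?thesis by (simp add: frac_integral_def algebra_simps)
qed

lemma norm_frac_integral_le:
  fixes y :: "real \<Rightarrow> 'a::euclidean_space" and b :: "real \<Rightarrow> real"
  assumes "q > 0" "continuous_on {0..s} y" "continuous_on {0..s} b"
    and le: "\<And>\<zeta>. \<zeta> \<in> {0..s} \<Longrightarrow> norm (y \<zeta>) \<le> b \<zeta>"
  shows "norm (frac_integral q y s) \<le> frac_integral q b s"
proof -
  have "norm (integral {0..s} (\<lambda>\<zeta>. (s - \<zeta>) powr (q - 1) *\<^sub>R y \<zeta>))
      \<le> integral {0..s} (\<lambda>\<zeta>. (s - \<zeta>) powr (q - 1) *\<^sub>R b \<zeta>)"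
    by (rule integral_norm_bound_integral)
      (use assms kernel_integrable[OF assms(1,2)] kernel_integrable[OF assms(1,3)]
        in \<open>auto intro!: mult_left_mono\<close>)
  then show ?thesis
    using Gamma_real_pos[OF \<open>q > 0\<close>] by (simp add: frac_integral_def divide_right_mono)
qed

lemma frac_integral_nth:
  assumes "q > 0" "continuous_on {0..s} (y :: real \<Rightarrow> real ^ 'n)"
  shows "frac_integral q y s $ j = frac_integral q (\<lambda>\<zeta>. y \<zeta> $ j) s"
  using integral_component_eq_cart[OF kernel_integrable[OF assms], of j]
  by (simp add: frac_integral_def)

lemma frac_integral_mono:
  fixes y b :: "real \<Rightarrow> real"
  assumes "q > 0" "continuous_on {0..s} y" "continuous_on {0..s} b"
    and le: "\<And>\<zeta>. \<zeta> \<in> {0..s} \<Longrightarrow> y \<zeta> \<le> b \<zeta>"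
  shows "frac_integral q y s \<le> frac_integral q b s"
proof -
  have "integral {0..s} (\<lambda>\<zeta>. (s - \<zeta>) powr (q - 1) *\<^sub>R y \<zeta>)
      \<le> integral {0..s} (\<lambda>\<zeta>. (s - \<zeta>) powr (q - 1) *\<^sub>R b \<zeta>)"
    by (rule integral_le)
      (use assms kernel_integrable[OF assms(1,2)] kernel_integrable[OF assms(1,3)]
        in \<open>auto intro!: mult_left_mono\<close>)
  then show ?thesis
    using Gamma_real_pos[OF \<open>q > 0\<close>] by (simp add: frac_integral_def divide_right_mono)
qed

lemma frac_integral_one:
  assumes "q > 0" "s \<ge> 0"
  shows "frac_integral q (\<lambda>_. 1 :: real) s = s powr q / (q * Gamma q)"
  using has_integral_kernel[OF assms] by (simp add: frac_integral_def integral_unique)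

section \<open>A weakly singular Gronwall inequality\<close>

text \<open>
  The bound is a multiple of the weight \<open>exp (\<mu> * s)\<close> itself, and on bounded time intervals a
  large rate \<open>\<mu>\<close> makes the multiple as small as desired. The small factor comes from
  \<open>exp (- y) \<le> y powr (- (q / 2))\<close> at \<open>y = \<mu> (s - \<zeta>)\<close>, which spends half of the exponent \<open>q\<close> and
  leaves the still integrable kernel \<open>(s - \<zeta>) powr (q / 2 - 1)\<close>.
\<close>

lemma frac_integral_exp_le:
  assumes "q > 0" "q \<le> 1" "\<mu> > 0" "s \<ge> 0"
  shows "frac_integral q (\<lambda>\<zeta>. exp (\<mu> * \<zeta>)) s
      \<le> exp (\<mu> * s) * \<mu> powr (- (q / 2)) * (s powr (q / 2) / (q / 2)) / Gamma q"
proof -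
  have exp_bound: "exp (- y) \<le> y powr (- (q / 2))" if "y > 0" for y :: real
  proof -
    have "(q / 2) * ln y \<le> y"
    proof (cases "ln y \<ge> 0")
      case True
      have "(q / 2) * ln y \<le> 1 * ln y" using True assms by (intro mult_right_mono) auto
      then show ?thesis using ln_le_minus_one[OF that] by simp
    next
      case False
      then have "(q / 2) * ln y \<le> 0" using assms by (simp add: mult_nonneg_nonpos)
      then show ?thesis using that by simp
    qed
    then show ?thesis using that by (simp add: powr_def)
  qed
  have bound: "(s - \<zeta>) powr (q - 1) * exp (\<mu> * \<zeta>)
      \<le> exp (\<mu> * s) * \<mu> powr (- (q / 2)) * (s - \<zeta>) powr (q / 2 - 1)" if "\<zeta> \<in> {0..s}" for \<zeta>
  proof (cases "\<zeta> = s")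
    case False
    then have t: "s - \<zeta> > 0" using that by simp
    have "exp (\<mu> * \<zeta>) = exp (\<mu> * s) * exp (- (\<mu> * (s - \<zeta>)))"
      by (simp add: exp_add [symmetric] algebra_simps)
    also have "\<dots> \<le> exp (\<mu> * s) * (\<mu> * (s - \<zeta>)) powr (- (q / 2))"
      using exp_bound[of "\<mu> * (s - \<zeta>)"] t assms by simp
    also have "\<dots> = exp (\<mu> * s) * \<mu> powr (- (q / 2)) * (s - \<zeta>) powr (- (q / 2))"
      using t assms by (simp add: powr_mult)
    finally have "(s - \<zeta>) powr (q - 1) * exp (\<mu> * \<zeta>)
        \<le> (s - \<zeta>) powr (q - 1) * (exp (\<mu> * s) * \<mu> powr (- (q / 2)) * (s - \<zeta>) powr (- (q / 2)))"
      by (intro mult_left_mono) auto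
    also have "\<dots> = exp (\<mu> * s) * \<mu> powr (- (q / 2)) * ((s - \<zeta>) powr (q - 1) * (s - \<zeta>) powr (- (q / 2)))"
      by (simp add: mult_ac)
    also have "(s - \<zeta>) powr (q - 1) * (s - \<zeta>) powr (- (q / 2)) = (s - \<zeta>) powr (q / 2 - 1)"
      by (simp add: powr_add [symmetric])
    finally show ?thesis .
  qed simp
  have "integral {0..s} (\<lambda>\<zeta>. (s - \<zeta>) powr (q - 1) *\<^sub>R exp (\<mu> * \<zeta>))
      \<le> integral {0..s} (\<lambda>\<zeta>. exp (\<mu> * s) * \<mu> powr (- (q / 2)) * (s - \<zeta>) powr (q / 2 - 1))"
  proof (rule integral_le)
    show "(\<lambda>\<zeta>. (s - \<zeta>) powr (q - 1) *\<^sub>R exp (\<mu> * \<zeta>)) integrable_on {0..s}"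
      using assms by (intro kernel_integrable continuous_intros)
    show "(\<lambda>\<zeta>. exp (\<mu> * s) * \<mu> powr (- (q / 2)) * (s - \<zeta>) powr (q / 2 - 1)) integrable_on {0..s}"
      using has_integral_mult_right[OF has_integral_kernel[of "q / 2" s]] assms
      by (auto simp: integrable_on_def)
  qed (use bound in simp)
  also have "\<dots> = exp (\<mu> * s) * \<mu> powr (- (q / 2)) * (s powr (q / 2) / (q / 2))"
    using has_integral_mult_right[OF has_integral_kernel[of "q / 2" s]] assms
    by (intro integral_unique) auto
  finally have "1 / Gamma q * integral {0..s} (\<lambda>\<zeta>. (s - \<zeta>) powr (q - 1) *\<^sub>R exp (\<mu> * \<zeta>))
      \<le> 1 / Gamma q * (exp (\<mu> * s) * \<mu> powr (- (q / 2)) * (s powr (q / 2) / (q / 2)))"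
    using Gamma_real_pos[OF \<open>q > 0\<close>] by (intro mult_left_mono) auto
  then show ?thesis by (simp add: frac_integral_def mult.commute[of q])
qed

text \<open>
  In the norm \<open>sup exp (- \<mu> s) e(s)\<close> with large \<open>\<mu>\<close>, the map \<open>e \<mapsto> I^q (M e)\<close> is a contraction
  with factor \<open>1 / 2\<close>, so the term in \<open>e\<close> can be absorbed into the left-hand side. The
  supremum is taken over \<open>[0, s0]\<close> only, where \<open>\<phi> \<le> \<phi> s0\<close>; this gives the bound by the value of
  \<open>\<phi>\<close> at the same time.
\<close>

lemma fractional_Gronwall:
  fixes T q M :: real
  assumes "T > 0" "q > 0" "q \<le> 1" "M \<ge> 0"
  shows "\<exists>c>0. \<forall>e \<phi>. continuous_on {0..T} e \<longrightarrow> continuous_on {0..T} \<phi> \<longrightarrow> mono_on {0..T} \<phi> \<longrightarrow>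
      (\<forall>s\<in>{0..T}. 0 \<le> e s) \<longrightarrow> (\<forall>s\<in>{0..T}. 0 \<le> \<phi> s) \<longrightarrow>
      (\<forall>s\<in>{0..T}. e s \<le> frac_integral q (\<lambda>\<zeta>. M * e \<zeta> + \<phi> \<zeta>) s) \<longrightarrow>
      (\<forall>s\<in>{0..T}. e s \<le> c * \<phi> s)"
proof -
  have \<Gamma>: "Gamma q > 0" using \<open>q > 0\<close> by (rule Gamma_real_pos)
  define Q where "Q = T powr (q / 2) / (q / 2) / Gamma q"
  define C where "C = T powr q / (q * Gamma q)"
  have "Q > 0" "C > 0" using assms \<Gamma> by (auto simp: Q_def C_def)
  \<comment> \<open>This rate makes \<open>M * \<mu> powr (- (q / 2)) * Q\<close> at most \<open>1 / 2\<close>, also when \<open>M = 0\<close>.\<close>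
  define \<mu> where "\<mu> = (2 * M * Q + 1) powr (2 / q)"
  have pos: "2 * M * Q + 1 > 0" using \<open>Q > 0\<close> \<open>M \<ge> 0\<close> by (simp add: add_nonneg_pos)
  then have "\<mu> > 0" by (simp add: \<mu>_def)
  have "\<mu> powr (- (q / 2)) = 1 / (2 * M * Q + 1)"
    using pos assms by (simp add: \<mu>_def powr_powr powr_minus_divide)
  then have "M * (\<mu> powr (- (q / 2)) * Q) = (M * Q) / (2 * M * Q + 1)" by simp
  also have "\<dots> \<le> 1 / 2" using pos by (simp add: pos_divide_le_eq)
  finally have half: "M * (\<mu> powr (- (q / 2)) * Q) \<le> 1 / 2" .
  have "e s0 \<le> 2 * C * exp (\<mu> * T) * \<phi> s0"
    if e: "continuous_on {0..T} e" and \<phi>: "continuous_on {0..T} \<phi>" and mono: "mono_on {0..T} \<phi>"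
      and e0: "\<forall>s\<in>{0..T}. 0 \<le> e s" and \<phi>0: "\<forall>s\<in>{0..T}. 0 \<le> \<phi> s"
      and le: "\<forall>s\<in>{0..T}. e s \<le> frac_integral q (\<lambda>\<zeta>. M * e \<zeta> + \<phi> \<zeta>) s"
      and s0: "s0 \<in> {0..T}"
    for e \<phi> :: "real \<Rightarrow> real" and s0
  proof -
    \<comment> \<open>Choose a time \<open>s1\<close> at which the weighted error \<open>exp (- \<mu> s) e(s)\<close> is maximal on \<open>[0, s0]\<close>.\<close>
    have "continuous_on {0..s0} (\<lambda>s. exp (- (\<mu> * s)) * e s)"
      using s0 by (intro continuous_intros continuous_on_subset[OF e]) auto
    then obtain s1 where s1: "s1 \<in> {0..s0}"
      and max: "\<And>s. s \<in> {0..s0} \<Longrightarrow> exp (- (\<mu> * s)) * e s \<le> exp (- (\<mu> * s1)) * e s1"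
      using continuous_attains_sup[of "{0..s0}" "\<lambda>s. exp (- (\<mu> * s)) * e s"] s0 by auto
    define m where "m = exp (- (\<mu> * s1)) * e s1"
    have "m \<ge> 0" using e0 s1 s0 by (simp add: m_def)
    have em: "e s \<le> m * exp (\<mu> * s)" if "s \<in> {0..s0}" for s
      using max[OF that] by (simp add: m_def exp_minus field_simps)
    have s1T: "s1 \<in> {0..T}" using s0 s1 by simp
    have sub: "{0..s1} \<subseteq> {0..T}" using s1T by auto
    have "e s1 \<le> frac_integral q (\<lambda>\<zeta>. M * e \<zeta> + \<phi> \<zeta>) s1" by (rule bspec[OF le s1T])
    also have "\<dots> \<le> frac_integral q (\<lambda>\<zeta>. (M * m) *\<^sub>R exp (\<mu> * \<zeta>) + \<phi> s0 *\<^sub>R 1) s1"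
    proof (rule frac_integral_mono[OF \<open>q > 0\<close>])
      fix \<zeta> assume \<zeta>: "\<zeta> \<in> {0..s1}"
      then have "\<phi> \<zeta> \<le> \<phi> s0" using mono s1 s0 by (auto simp: mono_on_def)
      moreover have "M * e \<zeta> \<le> M * (m * exp (\<mu> * \<zeta>))"
        using em[of \<zeta>] \<zeta> s1 \<open>M \<ge> 0\<close> by (intro mult_left_mono) auto
      ultimately show "M * e \<zeta> + \<phi> \<zeta> \<le> (M * m) *\<^sub>R exp (\<mu> * \<zeta>) + \<phi> s0 *\<^sub>R 1"
        by simp
    qed (intro continuous_intros continuous_on_subset[OF e sub] continuous_on_subset[OF \<phi> sub])+
    also have "\<dots> = (M * m) * frac_integral q (\<lambda>\<zeta>. exp (\<mu> * \<zeta>)) s1 + \<phi> s0 * (s1 powr q / (q * Gamma q))"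
      using s1 \<open>q > 0\<close> by (subst frac_integral_linear) (auto simp: frac_integral_one intro!: continuous_intros)
    also have "\<dots> \<le> (M * m) * (exp (\<mu> * s1) * (\<mu> powr (- (q / 2)) * Q)) + \<phi> s0 * C"
    proof (intro add_mono mult_left_mono)
      have "frac_integral q (\<lambda>\<zeta>. exp (\<mu> * \<zeta>)) s1
          \<le> exp (\<mu> * s1) * \<mu> powr (- (q / 2)) * (s1 powr (q / 2) / (q / 2)) / Gamma q"
        using assms \<open>\<mu> > 0\<close> s1 by (intro frac_integral_exp_le) auto
      also have "\<dots> = exp (\<mu> * s1) * (\<mu> powr (- (q / 2)) * (s1 powr (q / 2) / (q / 2) / Gamma q))"
        by simp
      also have "\<dots> \<le> exp (\<mu> * s1) * (\<mu> powr (- (q / 2)) * Q)"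
        unfolding Q_def using s1T assms \<Gamma>
        by (intro mult_left_mono divide_right_mono powr_mono2) auto
      finally show "frac_integral q (\<lambda>\<zeta>. exp (\<mu> * \<zeta>)) s1 \<le> exp (\<mu> * s1) * (\<mu> powr (- (q / 2)) * Q)" .
      show "s1 powr q / (q * Gamma q) \<le> C"
        unfolding C_def using s1T assms \<Gamma> by (intro divide_right_mono powr_mono2) auto
    qed (use \<open>M \<ge> 0\<close> \<open>m \<ge> 0\<close> bspec[OF \<phi>0 s0] in auto)
    also have "(M * m) * (exp (\<mu> * s1) * (\<mu> powr (- (q / 2)) * Q))
        = (m * exp (\<mu> * s1)) * (M * (\<mu> powr (- (q / 2)) * Q))" by simp
    also have "\<dots> \<le> (m * exp (\<mu> * s1)) * (1 / 2)"
      using half \<open>m \<ge> 0\<close> by (intro mult_left_mono) auto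
    also have "m * exp (\<mu> * s1) = e s1" by (simp add: m_def exp_minus field_simps)
    finally have "e s1 \<le> 2 * C * \<phi> s0" by (simp add: field_simps)
    moreover have "m \<le> e s1"
      unfolding m_def using bspec[OF e0 s1T] s1 \<open>\<mu> > 0\<close> by (intro mult_left_le_one_le) auto
    ultimately have "m \<le> 2 * C * \<phi> s0" by simp
    then have "m * exp (\<mu> * s0) \<le> (2 * C * \<phi> s0) * exp (\<mu> * T)"
      using s0 \<open>\<mu> > 0\<close> \<open>C > 0\<close> bspec[OF \<phi>0 s0] by (intro mult_mono) auto
    with em[of s0] s0 show ?thesis by (simp add: mult_ac)
  qed
  moreover have "2 * C * exp (\<mu> * T) > 0" using \<open>C > 0\<close> by simp
  ultimately show ?thesis by blast
qed

section \<open>The Mittag-Leffler function\<close>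

text \<open>
  Euler's integral restricted to \<open>[R, R + 1]\<close>. As \<open>R\<close> is arbitrary, \<open>Gamma\<close> outgrows every
  geometric sequence, which is what the convergence of the Mittag-Leffler series needs.
\<close>

lemma Gamma_ge_power:
  fixes R x :: real
  assumes "R > 0" "x \<ge> 0"
  shows "R powr x * exp (- (R + 1)) \<le> Gamma (x + 1)"
proof -
  have \<Gamma>: "((\<lambda>t. t powr x / exp t) has_integral Gamma (x + 1)) {0..}"
    using Gamma_integral_real[of "x + 1"] assms by simp
  have int: "(\<lambda>t. t powr x / exp t) integrable_on {R..R + 1}"
    using \<open>R > 0\<close> by (intro integrable_continuous_real continuous_intros) auto
  have "R powr x * exp (- (R + 1)) = integral {R..R + 1} (\<lambda>_. R powr x * exp (- (R + 1)))"
    by simp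
  also have "\<dots> \<le> integral {R..R + 1} (\<lambda>t. t powr x / exp t)"
  proof (rule integral_le[OF _ int])
    fix t assume "t \<in> {R..R + 1}"
    then show "R powr x * exp (- (R + 1)) \<le> t powr x / exp t"
      using assms by (simp add: divide_inverse exp_minus [symmetric]) (intro mult_mono powr_mono2; simp)
  qed (rule integrable_const_ivl)
  also have "\<dots> \<le> integral {0..} (\<lambda>t. t powr x / exp t)"
    using \<open>R > 0\<close> \<Gamma> int by (intro integral_subset_le) (auto simp: integrable_on_def)
  also have "\<dots> = Gamma (x + 1)" using \<Gamma> by (rule integral_unique)
  finally show ?thesis .
qed

lemma mittag_leffler_summable:
  fixes q t :: real
  assumes "q > 0" "t \<ge> 0"
  shows "summable (\<lambda>n. t ^ n / Gamma (real n * q + 1))"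
proof (rule summable_comparison_test'[where N = 0])
  \<comment> \<open>With \<open>R powr q = t + 1\<close> the terms are dominated by a geometric series of ratio \<open>t / (t + 1)\<close>.\<close>
  define R where "R = (t + 1) powr (1 / q)"
  have "R > 0" using assms by (simp add: R_def)
  have "R powr q = t + 1" using assms by (simp add: R_def powr_powr)
  then have Rn: "R powr (real n * q) = (t + 1) ^ n" for n
    using assms by (simp add: powr_powr [symmetric] powr_realpow mult.commute[of "real n"])
  show "summable (\<lambda>n. exp (R + 1) * (t / (t + 1)) ^ n)"
    using assms by (intro summable_mult summable_geometric) (simp add: field_simps)
  fix n
  have "0 < (t + 1) ^ n * exp (- (R + 1))" using assms by (intro mult_pos_pos) auto
  moreover have "(t + 1) ^ n * exp (- (R + 1)) \<le> Gamma (real n * q + 1)"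
    using Gamma_ge_power[OF \<open>R > 0\<close>, of "real n * q"] Rn[of n] assms by simp
  moreover have "Gamma (real n * q + 1) > 0"
    using assms by (intro Gamma_real_pos add_nonneg_pos) auto
  moreover from calculation
  have "t ^ n / Gamma (real n * q + 1) \<le> t ^ n / ((t + 1) ^ n * exp (- (R + 1)))"
    using assms by (metis divide_left_mono mult_pos_pos zero_le_power)
  ultimately have "norm (t ^ n / Gamma (real n * q + 1)) \<le> t ^ n / ((t + 1) ^ n * exp (- (R + 1)))"
    using assms by simp
  also have "\<dots> = exp (R + 1) * (t / (t + 1)) ^ n"
    by (simp only: exp_minus power_divide) (simp add: field_simps)
  finally show "norm (t ^ n / Gamma (real n * q + 1)) \<le> exp (R + 1) * (t / (t + 1)) ^ n" .
qed

text \<open>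
  The term of index 0 is 1 and the others are nonnegative; summability is what makes the value of
  the series meaningful.
\<close>

lemma mittag_leffler_ge_1:
  fixes q t :: real
  assumes "q > 0" "t \<ge> 0"
  shows "mittag_leffler q t \<ge> 1"
proof -
  have "(\<Sum>n<1. t ^ n / Gamma (real n * q + 1)) \<le> mittag_leffler q t"
    unfolding mittag_leffler_def using assms
    by (intro sum_le_suminf mittag_leffler_summable)
      (auto intro!: divide_nonneg_pos Gamma_real_pos add_nonneg_pos)
  then show ?thesis by simp
qed

section \<open>Stability of the optimal state\<close>

text \<open>
  The smallness condition is stronger than this contraction condition: by
  \<open>sqrt (4 l_G\<^sup>2 + 2 \<eta>\<^sup>2) \<ge> 2 l_G\<close> its left-hand side is at least
  \<open>(l_K / \<eta>)\<^sup>2 (8 l_G\<^sup>2 + 2 \<eta>\<^sup>2)\<close>, and \<open>2 l_G\<^sup>2 + 2 \<eta>\<^sup>2 \<ge> (l_G + \<eta>)\<^sup>2\<close>.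
\<close>

lemma smallness_imp_contraction:
  fixes l_G \<eta> l_K :: real
  assumes "l_G > 0" "\<eta> > 0"
    and small: "2 * (l_K\<^sup>2 / \<eta>\<^sup>2) * (l_G * sqrt (4 * l_G\<^sup>2 + 2 * \<eta>\<^sup>2) + 2 * l_G\<^sup>2 + \<eta>\<^sup>2) < 1"
  shows "(1 + l_G / \<eta>) * l_K < 1"
proof -
  have "2 * l_G = sqrt ((2 * l_G)\<^sup>2)" using \<open>l_G > 0\<close> by (subst real_sqrt_abs) simp
  also have "\<dots> \<le> sqrt (4 * l_G\<^sup>2 + 2 * \<eta>\<^sup>2)" by (simp add: power_mult_distrib)
  finally have "l_G * (2 * l_G) \<le> l_G * sqrt (4 * l_G\<^sup>2 + 2 * \<eta>\<^sup>2)"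
    using \<open>l_G > 0\<close> by (intro mult_left_mono) auto
  then have "2 * l_G\<^sup>2 \<le> l_G * sqrt (4 * l_G\<^sup>2 + 2 * \<eta>\<^sup>2)"
    by (simp add: power2_eq_square)
  moreover have "(\<eta> + l_G)\<^sup>2 \<le> 2 * \<eta>\<^sup>2 + 2 * l_G\<^sup>2"
    using zero_le_power2[of "\<eta> - l_G"] by (simp add: power2_eq_square algebra_simps)
  ultimately have "(\<eta> + l_G)\<^sup>2 \<le> 2 * (l_G * sqrt (4 * l_G\<^sup>2 + 2 * \<eta>\<^sup>2) + 2 * l_G\<^sup>2 + \<eta>\<^sup>2)"
    using zero_le_power2[of l_G] by argo
  then have "l_K\<^sup>2 / \<eta>\<^sup>2 * (\<eta> + l_G)\<^sup>2
      \<le> l_K\<^sup>2 / \<eta>\<^sup>2 * (2 * (l_G * sqrt (4 * l_G\<^sup>2 + 2 * \<eta>\<^sup>2) + 2 * l_G\<^sup>2 + \<eta>\<^sup>2))"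
    by (intro mult_left_mono) auto
  also have "\<dots> < 1" using small by (simp only: mult_ac)
  also have "l_K\<^sup>2 / \<eta>\<^sup>2 * (\<eta> + l_G)\<^sup>2 = ((1 + l_G / \<eta>) * l_K)\<^sup>2"
  proof -
    have "(1 + l_G / \<eta>) * l_K = l_K / \<eta> * (\<eta> + l_G)" using \<open>\<eta> > 0\<close> by (simp add: field_simps)
    then show ?thesis by (simp only: power_mult_distrib power_divide)
  qed
  finally show ?thesis by (simp add: power_less_one_iff abs_square_less_1)
qed

text \<open>
  Evaluating the state equation at time 0, where the fractional integral vanishes, identifies the
  nonlocal initial value with \<open>x 0\<close>.
\<close>

lemma Nash_state_frac_integral:
  fixes x u :: "real \<Rightarrow> real ^ 'n::finite"
  assumes "q > 0" and Nash: "general_Nash_equilibrium T q K \<Theta> f g x0 a x u"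
    and cont: "continuous_on {0..T} (\<lambda>\<zeta>. stack_f f \<zeta> (x \<zeta>) + stack_g g \<zeta> (x \<zeta>) (u \<zeta>))"
    and s: "s \<in> {0..T}"
  shows "x s = x 0 + frac_integral q (\<lambda>\<zeta>. stack_f f \<zeta> (x \<zeta>) + stack_g g \<zeta> (x \<zeta>) (u \<zeta>)) s"
proof (rule vec_eq_iff[THEN iffD2], rule allI)
  fix j
  have x: "x s $ j = x0 j + a j / T * integral {0..T} (\<lambda>\<zeta>. x \<zeta> $ j)
      + frac_integral q (\<lambda>\<zeta>. f j \<zeta> (x \<zeta> $ j) + g j \<zeta> (x \<zeta> $ j) (u \<zeta> $ j)) s"
    if "s \<in> {0..T}" for s
    using Nash that by (simp add: general_Nash_equilibrium_def)
  have "x 0 $ j = x0 j + a j / T * integral {0..T} (\<lambda>\<zeta>. x \<zeta> $ j)"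
    using x[of 0] s by (simp add: frac_integral_def)
  moreover have "continuous_on {0..s} (\<lambda>\<zeta>. stack_f f \<zeta> (x \<zeta>) + stack_g g \<zeta> (x \<zeta>) (u \<zeta>))"
    by (rule continuous_on_subset[OF cont]) (use s in auto)
  ultimately show "x s $ j = (x 0 + frac_integral q (\<lambda>\<zeta>. stack_f f \<zeta> (x \<zeta>) + stack_g g \<zeta> (x \<zeta>) (u \<zeta>)) s) $ j"
    using x[OF s] \<open>q > 0\<close> by (simp add: frac_integral_nth stack_f_def stack_g_def)
qed

theorem theorem5p4:
  fixes T q l_G \<eta>_G l_K l_g l_f :: real
    and K :: "'n::finite \<Rightarrow> ('n \<Rightarrow> real) \<Rightarrow> real set"
    and \<Theta> :: "'n \<Rightarrow> real ^ 'n \<Rightarrow> real ^ 'n \<Rightarrow> real"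
    and f :: "'n \<Rightarrow> real \<Rightarrow> real \<Rightarrow> real"
    and g :: "'n \<Rightarrow> real \<Rightarrow> real \<Rightarrow> real \<Rightarrow> real"
    and x0 a :: "'n \<Rightarrow> real"
    and \<phi> :: "real \<Rightarrow> real"
  assumes "T > 0" and "0 < q" and "q \<le> 1"
    and K_values: "\<And>j p. p \<in> (- {j}) \<rightarrow>\<^sub>E UNIV \<Longrightarrow> K j p \<noteq> {} \<and> closed (K j p) \<and> convex (K j p)"
    and cost: "convex_C1_own_strategy \<Theta>"
    and "l_G > 0" and "\<eta>_G > 0"
    and G_Lipschitz: "\<And>s1 s2 x1 x2 u1 u2. s1 \<in> {0..T} \<Longrightarrow> s2 \<in> {0..T} \<Longrightarrow>
        norm (pseudo_grad \<Theta> s2 x2 u2 - pseudo_grad \<Theta> s1 x1 u1)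
          \<le> l_G * (\<bar>s2 - s1\<bar> + norm (x2 - x1) + norm (u2 - u1))"
    and G_pseudomonotone: "\<And>s x u u1 u2. s \<in> {0..T} \<Longrightarrow>
        u1 \<in> prod_constraint K u \<Longrightarrow> u2 \<in> prod_constraint K u \<Longrightarrow>
        pseudo_grad \<Theta> s x u2 \<bullet> (u1 - u2) \<ge> 0 \<Longrightarrow>
        pseudo_grad \<Theta> s x u1 \<bullet> (u1 - u2) \<ge> \<eta>_G * (norm (u1 - u2))\<^sup>2"
    and "l_K \<ge> 0"
    and K_Lipschitz: "\<And>u1 u2 \<omega>.
        norm (closest_point (prod_constraint K u2) \<omega> - closest_point (prod_constraint K u1) \<omega>)
          \<le> l_K * norm (u2 - u1)"
    and g_cont: "continuous_on ({0..T} \<times> UNIV \<times> UNIV) (\<lambda>(s, x, u). stack_g g s x u)"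
    and "l_g > 0"
    and g_Lipschitz: "\<And>s x1 x2 u1 u2. s \<in> {0..T} \<Longrightarrow>
        norm (stack_g g s x2 u2 - stack_g g s x1 u1) \<le> l_g * (norm (x2 - x1) + norm (u2 - u1))"
    and f_cont: "continuous_on ({0..T} \<times> UNIV) (\<lambda>(s, x). stack_f f s x)"
    and "l_f > 0"
    and f_Lipschitz: "\<And>s x1 x2. s \<in> {0..T} \<Longrightarrow>
        norm (stack_f f s x2 - stack_f f s x1) \<le> l_f * norm (x2 - x1)"
    and smallness: "2 * (l_K\<^sup>2 / \<eta>_G\<^sup>2) *
        (l_G * sqrt (4 * l_G\<^sup>2 + 2 * \<eta>_G\<^sup>2) + 2 * l_G\<^sup>2 + \<eta>_G\<^sup>2) < 1"
    and "0 < (MAX j. \<bar>a j\<bar>)" and "(MAX j. \<bar>a j\<bar>) < 1"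
    and \<phi>_cont: "continuous_on {0..T} \<phi>"
    and \<phi>_nonneg: "\<And>s. s \<in> {0..T} \<Longrightarrow> 0 \<le> \<phi> s"
    and \<phi>_mono: "mono_on {0..T} \<phi>"
  shows "\<exists>c>0. \<forall>x u z \<upsilon>.
      general_Nash_equilibrium T q K \<Theta> f g x0 a x u \<longrightarrow>
      solves_inequality_system T q K \<Theta> f g \<phi> (x 0) z \<upsilon> \<longrightarrow>
      (\<forall>s\<in>{0..T}. norm (z s - x s) \<le> c * \<phi> s * mittag_leffler q s)"
proof -
  define L where "L = l_G / \<eta>_G / (1 - (1 + l_G / \<eta>_G) * l_K)"
  have contr: "(1 + l_G / \<eta>_G) * l_K < 1"
    using \<open>l_G > 0\<close> \<open>\<eta>_G > 0\<close> smallness by (rule smallness_imp_contraction)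
  then have "L \<ge> 0" using \<open>l_G > 0\<close> \<open>\<eta>_G > 0\<close> by (simp add: L_def)
  have K_closed_convex: "\<And>j p. p \<in> (- {j}) \<rightarrow>\<^sub>E UNIV \<Longrightarrow> closed (K j p) \<and> convex (K j p)"
    using K_values by blast
  have K_convex: "\<And>j p. p \<in> (- {j}) \<rightarrow>\<^sub>E UNIV \<Longrightarrow> convex (K j p)"
    using K_values by blast
  note K_sets = closed_prod_constraint[of K, OF K_closed_convex]
    convex_prod_constraint[of K, OF K_closed_convex]
  define M where "M = l_f + l_g * (1 + L)"
  have "M \<ge> 0" using \<open>l_f > 0\<close> \<open>l_g > 0\<close> \<open>L \<ge> 0\<close> by (simp add: M_def)
  obtain c where "c > 0" and Gronwall:
    "\<forall>e \<phi>. continuous_on {0..T} e \<longrightarrow> continuous_on {0..T} \<phi> \<longrightarrow> mono_on {0..T} \<phi> \<longrightarrow>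
      (\<forall>s\<in>{0..T}. 0 \<le> e s) \<longrightarrow> (\<forall>s\<in>{0..T}. 0 \<le> \<phi> s) \<longrightarrow>
      (\<forall>s\<in>{0..T}. e s \<le> frac_integral q (\<lambda>\<zeta>. M * e \<zeta> + \<phi> \<zeta>) s) \<longrightarrow>
      (\<forall>s\<in>{0..T}. e s \<le> c * \<phi> s)"
    using fractional_Gronwall[OF \<open>T > 0\<close> \<open>0 < q\<close> \<open>q \<le> 1\<close> \<open>M \<ge> 0\<close>] by blast
  have "norm (z s - x s) \<le> c * \<phi> s * mittag_leffler q s"
    if Nash: "general_Nash_equilibrium T q K \<Theta> f g x0 a x u"
      and ineq: "solves_inequality_system T q K \<Theta> f g \<phi> (x 0) z \<upsilon>" and s: "s \<in> {0..T}"
    for x u z \<upsilon> s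
  proof -
    have x: "continuous_on {0..T} x" and u: "continuous_on {0..T} u"
      using Nash by (auto simp: general_Nash_equilibrium_def)
    from ineq obtain h where z: "continuous_on {0..T} z" and \<upsilon>: "continuous_on {0..T} \<upsilon>"
      and h: "continuous_on {0..T} h" and h\<phi>: "\<And>s. s \<in> {0..T} \<Longrightarrow> norm (h s) \<le> \<phi> s"
      and z_eq: "\<And>s. s \<in> {0..T} \<Longrightarrow> z s = z 0 +
           frac_integral q (\<lambda>\<zeta>. stack_f f \<zeta> (z \<zeta>) + stack_g g \<zeta> (z \<zeta>) (\<upsilon> \<zeta>) + h \<zeta>) s"
      and \<upsilon>K: "\<And>s. s \<in> {0..T} \<Longrightarrow> \<upsilon> s \<in> prod_constraint K (\<upsilon> s)"
      and \<upsilon>VI: "\<And>s w. s \<in> {0..T} \<Longrightarrow> w \<in> prod_constraint K (\<upsilon> s) \<Longrightarrow>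
           pseudo_grad \<Theta> s (z s) (\<upsilon> s) \<bullet> (w - \<upsilon> s) \<ge> 0"
      and z0: "z 0 = x 0"
      unfolding solves_inequality_system_def by blast
    have strategies: "norm (\<upsilon> s - u s) \<le> L * norm (z s - x s)" if s: "s \<in> {0..T}" for s
    proof -
      have min: "is_arg_min (\<lambda>w. \<Theta> j (x s) (subst_comp j w (u s)))
          (\<lambda>w. w \<in> K j (omit j (u s))) (u s $ j)" for j
        using Nash s by (simp add: general_Nash_equilibrium_def)
      note Nash_VI = Nash_imp_variational_inequality(1)[where K = K, OF cost K_convex min]
        Nash_imp_variational_inequality(2)[where K = K and s = s, OF cost K_convex min]
      have "norm (\<upsilon> s - u s) \<le> (1 + l_G / \<eta>_G) * (l_K * norm (\<upsilon> s - u s))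
          + l_G / \<eta>_G * norm (z s - x s)"
      proof (rule quasi_variational_stability[where C\<^sub>1 = "prod_constraint K (u s)"
            and C\<^sub>2 = "prod_constraint K (\<upsilon> s)" and A\<^sub>1 = "pseudo_grad \<Theta> s (x s)"
            and A\<^sub>2 = "pseudo_grad \<Theta> s (z s)"])
        show "norm (pseudo_grad \<Theta> s (x s) w - pseudo_grad \<Theta> s (z s) (\<upsilon> s))
            \<le> l_G * (norm (z s - x s) + norm (w - \<upsilon> s))" for w
          using G_Lipschitz[OF s s, of "x s" w "z s" "\<upsilon> s"] by (simp add: norm_minus_commute)
      qed (use K_sets Nash_VI \<upsilon>K \<upsilon>VI G_pseudomonotone K_Lipschitz s \<open>l_G > 0\<close> \<open>\<eta>_G > 0\<close> in auto)
      then have "norm (\<upsilon> s - u s) * (1 - (1 + l_G / \<eta>_G) * l_K) \<le> l_G / \<eta>_G * norm (z s - x s)"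
        by (simp add: algebra_simps)
      then have "norm (\<upsilon> s - u s) \<le> l_G / \<eta>_G * norm (z s - x s) / (1 - (1 + l_G / \<eta>_G) * l_K)"
        using contr by (simp only: pos_le_divide_eq diff_gt_0_iff_gt)
      then show ?thesis by (simp add: L_def)
    qed
    define F where "F = (\<lambda>\<zeta>. stack_f f \<zeta> (x \<zeta>) + stack_g g \<zeta> (x \<zeta>) (u \<zeta>))"
    define F' where "F' = (\<lambda>\<zeta>. stack_f f \<zeta> (z \<zeta>) + stack_g g \<zeta> (z \<zeta>) (\<upsilon> \<zeta>) + h \<zeta>)"
    have drift: "continuous_on {0..T} (\<lambda>\<zeta>. stack_f f \<zeta> (y \<zeta>) + stack_g g \<zeta> (y \<zeta>) (w \<zeta>))"
      if "continuous_on {0..T} y" "continuous_on {0..T} w" for y w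
    proof (rule continuous_on_add)
      have "continuous_on {0..T} (\<lambda>\<zeta>. (\<zeta>, y \<zeta>))" by (intro continuous_intros that)
      from continuous_on_compose2[OF f_cont this]
      show "continuous_on {0..T} (\<lambda>\<zeta>. stack_f f \<zeta> (y \<zeta>))" by auto
      have "continuous_on {0..T} (\<lambda>\<zeta>. (\<zeta>, y \<zeta>, w \<zeta>))" by (intro continuous_intros that)
      from continuous_on_compose2[OF g_cont this]
      show "continuous_on {0..T} (\<lambda>\<zeta>. stack_g g \<zeta> (y \<zeta>) (w \<zeta>))" by auto
    qed
    have F: "continuous_on {0..T} F" and F': "continuous_on {0..T} F'"
      unfolding F_def F'_def by (intro continuous_on_add drift x u z \<upsilon> h)+
    have drift_le: "norm (F' \<zeta> - F \<zeta>) \<le> M * norm (z \<zeta> - x \<zeta>) + \<phi> \<zeta>" if \<zeta>: "\<zeta> \<in> {0..T}" for \<zeta>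
    proof -
      have "F' \<zeta> - F \<zeta> = (stack_f f \<zeta> (z \<zeta>) - stack_f f \<zeta> (x \<zeta>))
          + (stack_g g \<zeta> (z \<zeta>) (\<upsilon> \<zeta>) - stack_g g \<zeta> (x \<zeta>) (u \<zeta>)) + h \<zeta>"
        by (simp add: F_def F'_def)
      then have "norm (F' \<zeta> - F \<zeta>) \<le> norm (stack_f f \<zeta> (z \<zeta>) - stack_f f \<zeta> (x \<zeta>))
          + norm (stack_g g \<zeta> (z \<zeta>) (\<upsilon> \<zeta>) - stack_g g \<zeta> (x \<zeta>) (u \<zeta>)) + norm (h \<zeta>)"
        by (metis norm_triangle_le norm_triangle_ineq add_mono order_refl)
      also have "\<dots> \<le> l_f * norm (z \<zeta> - x \<zeta>)
          + l_g * (norm (z \<zeta> - x \<zeta>) + L * norm (z \<zeta> - x \<zeta>)) + \<phi> \<zeta>"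
        using strategies[OF \<zeta>] \<open>l_g > 0\<close>
        by (intro add_mono f_Lipschitz[OF \<zeta>] h\<phi>[OF \<zeta>] order_trans[OF g_Lipschitz[OF \<zeta>]]) auto
      finally show ?thesis by (simp add: M_def algebra_simps)
    qed
    have "norm (z s - x s) \<le> c * \<phi> s"
    proof (rule Gronwall[rule_format, OF _ \<phi>_cont \<phi>_mono _ _ _ s])
      show "continuous_on {0..T} (\<lambda>s. norm (z s - x s))"
        by (intro continuous_intros z x)
      fix s assume s: "s \<in> {0..T}"
      then have sub: "{0..s} \<subseteq> {0..T}" by auto
      have "z s - x s = frac_integral q F' s - frac_integral q F s"
        using z_eq[OF s] Nash_state_frac_integral[OF \<open>0 < q\<close> Nash drift[OF x u] s] z0
        by (simp add: F_def F'_def)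
      also have "\<dots> = frac_integral q (\<lambda>\<zeta>. 1 *\<^sub>R F' \<zeta> + (- 1) *\<^sub>R F \<zeta>) s"
        by (subst frac_integral_linear[OF \<open>0 < q\<close> continuous_on_subset[OF F' sub]
              continuous_on_subset[OF F sub]]) simp
      also have "norm \<dots> \<le> frac_integral q (\<lambda>\<zeta>. M * norm (z \<zeta> - x \<zeta>) + \<phi> \<zeta>) s"
        using drift_le sub
        by (intro norm_frac_integral_le \<open>0 < q\<close> continuous_intros)
          (auto intro: continuous_on_subset[OF _ sub] F F' z x \<phi>_cont)
      finally show "norm (z s - x s) \<le> frac_integral q (\<lambda>\<zeta>. M * norm (z \<zeta> - x \<zeta>) + \<phi> \<zeta>) s" .
    qed (use \<phi>_nonneg in auto)
    also have "\<dots> \<le> c * \<phi> s * mittag_leffler q s"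
      using mult_left_mono[OF mittag_leffler_ge_1[of q s], of "c * \<phi> s"]
        \<open>0 < q\<close> \<open>c > 0\<close> \<phi>_nonneg[OF s] s by simp
    finally show ?thesis .
  qed
  with \<open>c > 0\<close> show ?thesis by blast
qed

end
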